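(* Let $X=\{x_1,\dots,x_n\}$ be a finite set with $n\ge 1$ elements in a fixed enumeration, and let $(X,\bullet)$ be any groupoid on $X$. Then $(X,\bullet)$ has an $OJ$-factorization, i.e. $(X,\bullet)=O(X,\bullet)\diamond J(X,\bullet)$.
   Context: A groupoid $(X,\bullet)$ is a non-empty set $X$ with an arbitrary binary operation $\bullet:X\times X\to X$. For groupoids $(X,\ast)$, $(X,\circ)$ on the same set $X$, the product $(X,\ast)\diamond(X,\circ)$ is the groupoid $(X,\cdot)$ with $x\cdot y=(x\ast y)\circ(y\ast x)$ for all $x,y\in X$. Let $X=\{x_1,\dots,x_n\}$ be finite with a fixed enumeration. The orient-factor $O(X,\bullet)=(X,\ast)$ is obtained from the left-zero-semigroup on $X$ by reversing its anti-diagonal: $x_i\ast x_j=x_j$ if $i+j=n+1$, and $x_i\ast x_j=x_i$ otherwise. The skew-factor $J(X,\bullet)=(X,\circ)$ is obtained from $(X,\bullet)$ by reversing its anti-diagonal: $x_i\circ x_j=x_j\bullet x_i$ if $i+j=n+1$, and $x_i\circ x_j=x_i\bullet x_j$ otherwise. *)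

theory Defs
  imports Main "HOL-Library.FuncSet"
begin

text \<open>
  A groupoid is a carrier with a binary operation. Operations are required to be extensional
  (\<open>undefined\<close> off the carrier), so that equality of records is equality of groupoids.
\<close>

record 'a groupoid =
  carrier :: "'a set"
  gop :: "'a \<Rightarrow> 'a \<Rightarrow> 'a" (infixl \<open>\<bullet>\<index>\<close> 70)

definition is_groupoid :: "'a groupoid \<Rightarrow> bool" where
  "is_groupoid G \<longleftrightarrow>
     carrier G \<noteq> {} \<and> gop G \<in> carrier G \<rightarrow>\<^sub>E carrier G \<rightarrow>\<^sub>E carrier G"

text \<open>The product is only meaningful for two groupoids with the same carrier.\<close>

definition groupoid_prod :: "'a groupoid \<Rightarrow> 'a groupoid \<Rightarrow> 'a groupoid" (infixl \<open>\<diamond>\<close> 65) where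
  "A \<diamond> B =
     \<lparr>carrier = carrier A,
      gop = (\<lambda>x\<in>carrier A. \<lambda>y\<in>carrier A. (x \<bullet>\<^bsub>A\<^esub> y) \<bullet>\<^bsub>B\<^esub> (y \<bullet>\<^bsub>A\<^esub> x))\<rparr>"

definition left_zero :: "'a set \<Rightarrow> 'a groupoid" where
  "left_zero X = \<lparr>carrier = X, gop = (\<lambda>x\<in>X. \<lambda>y\<in>X. x)\<rparr>"

text \<open>
  The enumeration \<open>x\<^sub>1, \<dots>, x\<^sub>n\<close> of the carrier is a function \<open>e\<close> with
  \<open>bij_betw e {1..n} X\<close>; its values outside \<open>{1..n}\<close> are irrelevant.
\<close>

definition on_antidiag :: "nat \<Rightarrow> (nat \<Rightarrow> 'a) \<Rightarrow> 'a \<Rightarrow> 'a \<Rightarrow> bool" where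
  "on_antidiag n e x y \<longleftrightarrow>
     (\<exists>i\<in>{1..n}. \<exists>j\<in>{1..n}. x = e i \<and> y = e j \<and> i + j = n + 1)"

definition reverse_antidiag :: "nat \<Rightarrow> (nat \<Rightarrow> 'a) \<Rightarrow> 'a groupoid \<Rightarrow> 'a groupoid" where
  "reverse_antidiag n e G =
     \<lparr>carrier = carrier G,
      gop = (\<lambda>x\<in>carrier G. \<lambda>y\<in>carrier G.
               if on_antidiag n e x y then y \<bullet>\<^bsub>G\<^esub> x else x \<bullet>\<^bsub>G\<^esub> y)\<rparr>"

definition orient_factor :: "nat \<Rightarrow> (nat \<Rightarrow> 'a) \<Rightarrow> 'a groupoid \<Rightarrow> 'a groupoid" where
  "orient_factor n e G = reverse_antidiag n e (left_zero (carrier G))"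

definition skew_factor :: "nat \<Rightarrow> (nat \<Rightarrow> 'a) \<Rightarrow> 'a groupoid \<Rightarrow> 'a groupoid" where
  "skew_factor n e G = reverse_antidiag n e G"

definition has_OJ_factorization :: "nat \<Rightarrow> (nat \<Rightarrow> 'a) \<Rightarrow> 'a groupoid \<Rightarrow> bool" where
  "has_OJ_factorization n e G \<longleftrightarrow> G = orient_factor n e G \<diamond> skew_factor n e G"

lemma carrier_orient_factor [simp]: "carrier (orient_factor n e G) = carrier G"
  by (simp add: orient_factor_def reverse_antidiag_def left_zero_def)

lemma carrier_skew_factor [simp]: "carrier (skew_factor n e G) = carrier G"
  by (simp add: skew_factor_def reverse_antidiag_def)

lemma gop_closed:
  assumes "is_groupoid G" "x \<in> carrier G" "y \<in> carrier G"
  shows "x \<bullet>\<^bsub>G\<^esub> y \<in> carrier G"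
  using assms unfolding is_groupoid_def by (meson PiE_mem)

lemma is_groupoid_left_zero: "X \<noteq> {} \<Longrightarrow> is_groupoid (left_zero X)"
  by (auto simp: is_groupoid_def left_zero_def)

lemma is_groupoid_reverse_antidiag:
  "is_groupoid G \<Longrightarrow> is_groupoid (reverse_antidiag n e G)"
  using gop_closed[of G] by (auto simp: is_groupoid_def reverse_antidiag_def)

lemma is_groupoid_orient_factor: "is_groupoid G \<Longrightarrow> is_groupoid (orient_factor n e G)"
  unfolding orient_factor_def
  by (intro is_groupoid_reverse_antidiag is_groupoid_left_zero) (simp add: is_groupoid_def)

lemma is_groupoid_skew_factor: "is_groupoid G \<Longrightarrow> is_groupoid (skew_factor n e G)"
  unfolding skew_factor_def by (rule is_groupoid_reverse_antidiag)

lemma is_groupoid_prod: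
  "is_groupoid A \<Longrightarrow> is_groupoid B \<Longrightarrow> carrier A = carrier B \<Longrightarrow> is_groupoid (A \<diamond> B)"
  using gop_closed[of A] gop_closed[of B] by (auto simp: is_groupoid_def groupoid_prod_def)

lemma on_antidiag_enum:
  assumes "bij_betw e {1..n} X" "i \<in> {1..n}" "j \<in> {1..n}"
  shows "on_antidiag n e (e i) (e j) \<longleftrightarrow> i + j = n + 1"
  using assms unfolding on_antidiag_def bij_betw_def by (metis inj_onD)

lemma orient_factor_enum:
  assumes "bij_betw e {1..n} (carrier G)" "i \<in> {1..n}" "j \<in> {1..n}"
  shows "e i \<bullet>\<^bsub>orient_factor n e G\<^esub> e j = (if i + j = n + 1 then e j else e i)"
  using on_antidiag_enum[OF assms] bij_betwE[OF assms(1)] assms(2,3)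
  by (simp add: orient_factor_def reverse_antidiag_def left_zero_def)

lemma skew_factor_enum:
  assumes "bij_betw e {1..n} (carrier G)" "i \<in> {1..n}" "j \<in> {1..n}"
  shows "e i \<bullet>\<^bsub>skew_factor n e G\<^esub> e j =
           (if i + j = n + 1 then e j \<bullet>\<^bsub>G\<^esub> e i else e i \<bullet>\<^bsub>G\<^esub> e j)"
  using on_antidiag_enum[OF assms] bij_betwE[OF assms(1)] assms(2,3)
  by (simp add: skew_factor_def reverse_antidiag_def)

end

theory Submission imports Defs begin

text \<open>
  Off the anti-diagonal, the orient-factor leaves a pair alone and the skew-factor agrees with the
  given operation. On it, the orient-factor swaps the pair and the skew-factor, the anti-diagonal
  being symmetric, swaps it back.
\<close>

text \<open>The product evaluates the orient-factor at \<open>(x, y)\<close> and at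
  \<open>(y, x)\<close>, so one case split must settle both pairs.\<close>

lemma on_antidiag_sym:
  assumes "on_antidiag n e x y"
  shows "on_antidiag n e y x"
proof -
  from assms obtain i j where "i \<in> {1..n}" "j \<in> {1..n}" "x = e i" "y = e j" "i + j = n + 1"
    unfolding on_antidiag_def by blast
  moreover from this have "j + i = n + 1" by simp
  ultimately show ?thesis unfolding on_antidiag_def by blast
qed

lemma gop_groupoid_prod_OJ:
  assumes "x \<in> carrier G" "y \<in> carrier G"
  shows "x \<bullet>\<^bsub>orient_factor n e G \<diamond> skew_factor n e G\<^esub> y = x \<bullet>\<^bsub>G\<^esub> y"
proof (cases "on_antidiag n e x y")
  case True
  \<comment> \<open>The orient-factor gives \<open>y\<close> at \<open>(x, y)\<close> and
    \<open>x\<close> at \<open>(y, x)\<close>; the skew-factor at \<open>(y, x)\<close> then returns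
    the value of \<open>G\<close> at \<open>(x, y)\<close>.\<close>
  with on_antidiag_sym[OF True] assms show ?thesis
    by (simp add: groupoid_prod_def orient_factor_def skew_factor_def
        reverse_antidiag_def left_zero_def)
next
  case False
  then have "\<not> on_antidiag n e y x" by (blast dest: on_antidiag_sym)
  with False assms show ?thesis
    by (simp add: groupoid_prod_def orient_factor_def skew_factor_def
        reverse_antidiag_def left_zero_def)
qed

text \<open>Both operations are \<open>undefined\<close> off the common carrier, so their values on
  it determine them.\<close>

lemma groupoid_eqI:
  fixes A B :: "'a groupoid"
  assumes "is_groupoid A" "is_groupoid B" "carrier A = carrier B"
    and "\<And>x y. x \<in> carrier A \<Longrightarrow> y \<in> carrier A \<Longrightarrow> x \<bullet>\<^bsub>A\<^esub> y = x \<bullet>\<^bsub>B\<^esub> y"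
  shows "A = B"
proof -
  have A: "gop A \<in> carrier A \<rightarrow>\<^sub>E carrier A \<rightarrow>\<^sub>E carrier A"
    and B: "gop B \<in> carrier A \<rightarrow>\<^sub>E carrier A \<rightarrow>\<^sub>E carrier A"
    using assms(1-3) by (simp_all add: is_groupoid_def)
  have "gop A = gop B"
  \<comment> \<open>The operations are curried: extensionality is used once for the outer argument
    and once for the row \<open>gop A x\<close>.\<close>
  proof (rule PiE_ext[OF A B])
    fix x assume x: "x \<in> carrier A"
    show "gop A x = gop B x"
      by (rule PiE_ext[OF PiE_mem[OF A x] PiE_mem[OF B x]]) (rule assms(4)[OF x])
  qed
  \<comment> \<open>The remaining field \<open>more\<close> has type \<open>unit\<close>, so it
    agrees trivially.\<close>
  with assms(3) show ?thesis by (intro groupoid.equality) simp_all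
qed

theorem theorem4p1p2:
  fixes n :: nat and X :: "'a set" and e :: "nat \<Rightarrow> 'a" and G :: "'a groupoid"
  assumes "n \<ge> 1"
    and "bij_betw e {1..n} X"
    and "is_groupoid G"
    and "carrier G = X"
  shows "has_OJ_factorization n e G"
  unfolding has_OJ_factorization_def
proof (rule groupoid_eqI)
  show "is_groupoid G" by (fact assms(3))
  \<comment> \<open>This supplies the extensionality of the product, so that computing on the
    carrier suffices.\<close>
  show "is_groupoid (orient_factor n e G \<diamond> skew_factor n e G)"
    using assms(3) by (simp add: is_groupoid_prod is_groupoid_orient_factor is_groupoid_skew_factor)
  show "carrier G = carrier (orient_factor n e G \<diamond> skew_factor n e G)"
    by (simp add: groupoid_prod_def)
qed (simp add: gop_groupoid_prod_OJ)

end
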